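(* Let $\mathbb{K}$ be an algebraically closed field of characteristic zero and let $A\subseteq\mathbb{K}[x]$ be a subalgebra of finite codimension $n>1$ with spectrum $Sp(A)=\{\alpha_1,\ldots,\alpha_s\}$ ($\alpha_1,\dots,\alpha_s$ distinct). (1) There exists $N>1$ such that $A$ can be described by $n$ conditions of the form $$\sum_{i=0}^{N-1}\sum_{j=1}^s c_{ij}\,p^{(i)}(\alpha_j)=0\qquad(c_{ij}\in\mathbb{K}),$$ that is, there are $n$ such conditions for which a polynomial $p\in\mathbb{K}[x]$ belongs to $A$ if and only if all $n$ conditions hold for $p$. (2) If $A$ has only one cluster, then the $n$ conditions describing $A$ can be chosen so that $s-1$ of them are $p(\alpha_1)=p(\alpha_j)$ for $j=2,\dots,s$ and the remaining ones have the form $$\sum_{i=1}^{N-1}\sum_{j=1}^s c_{ij}\,p^{(i)}(\alpha_j)=0,$$ i.e. involve only derivatives of order at least one.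
   Context: Subalgebras of $\mathbb{K}[x]$ contain all constants; the codimension of $A$ is $\dim_{\mathbb{K}}\mathbb{K}[x]/A$. For a subalgebra $A$ of finite codimension, its spectrum $Sp(A)$ is the set of $\alpha\in\mathbb{K}$ such that either $f'(\alpha)=0$ for all $f\in A$, or there exists $\beta\neq\alpha$ in $\mathbb{K}$ with $f(\alpha)=f(\beta)$ for all $f\in A$. Write $\alpha\sim\beta$ if $f(\alpha)=f(\beta)$ for all $f\in A$; the equivalence classes of $\sim$ on $Sp(A)$ are called clusters. $p^{(i)}$ is the $i$-th derivative, $p^{(0)}=p$. *)

theory Defs
  imports "HOL-Computational_Algebra.Polynomial"
begin

definition is_subalgebra :: "'a::field poly set \<Rightarrow> bool" where
  "is_subalgebra A \<longleftrightarrow>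
     module.subspace smult A \<and> 1 \<in> A \<and> (\<forall>p\<in>A. \<forall>q\<in>A. p * q \<in> A)"

text \<open>The quotient \<open>K[x]/A\<close> has dimension \<open>n\<close> when the cosets of some
  \<open>b 0, \<dots>, b (n - 1)\<close> form a basis of it, i.e. they are linearly independent
  modulo \<open>A\<close> and span modulo \<open>A\<close>.\<close>

definition has_codim :: "'a::field poly set \<Rightarrow> nat \<Rightarrow> bool" where
  "has_codim A n \<longleftrightarrow>
     (\<exists>b :: nat \<Rightarrow> 'a poly.
        (\<forall>c. (\<Sum>i<n. smult (c i) (b i)) \<in> A \<longrightarrow> (\<forall>i<n. c i = 0)) \<and>
        (\<forall>p. \<exists>c. p - (\<Sum>i<n. smult (c i) (b i)) \<in> A))"

definition spectrum :: "'a::field poly set \<Rightarrow> 'a set" where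
  "spectrum A =
     {\<alpha>. (\<forall>f\<in>A. poly (pderiv f) \<alpha> = 0) \<or>
         (\<exists>\<beta>. \<beta> \<noteq> \<alpha> \<and> (\<forall>f\<in>A. poly f \<alpha> = poly f \<beta>))}"

definition cluster_rel :: "'a::field poly set \<Rightarrow> ('a \<times> 'a) set" where
  "cluster_rel A =
     {(\<alpha>, \<beta>). \<alpha> \<in> spectrum A \<and> \<beta> \<in> spectrum A \<and> (\<forall>f\<in>A. poly f \<alpha> = poly f \<beta>)}"

lemma equiv_cluster_rel: "equiv (spectrum A) (cluster_rel A)"
  by (rule equivI) (auto simp: cluster_rel_def refl_on_def sym_def trans_def)

definition clusters :: "'a::field poly set \<Rightarrow> 'a set set" where
  "clusters A = spectrum A // cluster_rel A"

end

theory Submission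
  imports Defs "HOL-Library.Function_Algebras"
begin

text \<open>
  Both parts are linear algebra in the annihilator of \<open>A\<close>, the space of linear functionals on
  \<open>K[x]\<close> that vanish on \<open>A\<close>: it has dimension \<open>n\<close>, and any basis of it cuts out \<open>A\<close>. What has to
  be shown is that every functional in the annihilator is a combination of the functionals
  \<open>p \<mapsto> p\<^sup>(\<^sup>i\<^sup>)(\<alpha> j)\<close> with \<open>i\<close> bounded. A functional is a combination of finitely many
  others as soon as it vanishes on their common kernel (\<open>in_span_functionals\<close>), so it suffices
  that a polynomial vanishing to high order at every point of the spectrum lies in \<open>A\<close>.

  This follows from the conductor, the ideal of all \<open>g\<close> with \<open>g K[x] \<subseteq> A\<close>. It is nonzero because
  \<open>A\<close> contains a nonconstant \<open>f\<close>, and \<open>K[x]\<close> is generated by finitely many monomials as a module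
  over \<open>K[f]\<close> (\<open>conductor_nonzero\<close>). A generator \<open>g\<close> of the conductor has all its roots in the
  spectrum: at a root \<open>\<alpha>\<close> outside the spectrum, \<open>A\<close> has an element with a simple zero at \<open>\<alpha>\<close> and
  elements separating \<open>\<alpha>\<close> from the other roots, and products of these show that one factor
  \<open>x - \<alpha>\<close> of \<open>g\<close> can be dropped (\<open>conductor_root_in_spectrum\<close>). Hence a polynomial that
  vanishes at the points of the spectrum to order at least \<open>degree g\<close> is divisible by \<open>g\<close>.

  If there is only one cluster, the differences \<open>p \<mapsto> p(\<alpha> 1) - p(\<alpha> j)\<close> are independent
  elements of the annihilator. Since a functional in the annihilator kills the constant \<open>1\<close>, the
  coefficients of its order-zero terms add up to \<open>0\<close>, so these terms combine to a combination of
  the differences, and what remains involves derivatives of positive order only. Extending the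
  differences to a basis by functionals of the latter kind gives the second part.
\<close>

section \<open>Annihilators of finite families of linear functionals\<close>

text \<open>Scaling of functionals is a named constant: with a bare lambda abstraction, the laws of a vector
space would act as rewrite rules on arbitrary products under an abstraction.\<close>

definition scale_fun :: "'a::field \<Rightarrow> ('b \<Rightarrow> 'a) \<Rightarrow> 'b \<Rightarrow> 'a" where
  "scale_fun c L = (\<lambda>x. c * L x)"

lemma scale_fun_apply [simp]: "scale_fun c L x = c * L x"
  by (simp add: scale_fun_def)

global_interpretation functionals: vector_space scale_fun
  by unfold_locales (auto simp: fun_eq_iff algebra_simps)

lemma sum_fun_apply: "(\<Sum>i\<in>I. f i) x = (\<Sum>i\<in>I. f i x)" for f :: "'i \<Rightarrow> 'b \<Rightarrow> 'a::comm_monoid_add"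
  by (induction I rule: infinite_finite_induct) simp_all

lemma span_image_functionals:
  fixes L :: "'i \<Rightarrow> 'b \<Rightarrow> 'a::field"
  assumes "finite I" and "\<phi> \<in> functionals.span (L ` I)"
  shows "\<exists>c. \<forall>x. \<phi> x = (\<Sum>i\<in>I. c i * L i x)"
  using assms(2)
proof (induction rule: functionals.span_induct_alt)
  case base
  show ?case by (rule exI[of _ "\<lambda>_. 0"]) simp
next
  case (step a M \<psi>)
  from step(1) obtain i where i: "i \<in> I" "M = L i" by blast
  from step(2) obtain c where c: "\<And>x. \<psi> x = (\<Sum>i\<in>I. c i * L i x)" by blast
  have "(scale_fun a M + \<psi>) x = (\<Sum>j\<in>I. ((if j = i then a else 0) + c j) * L j x)" for x
    using i \<open>finite I\<close>
    by (simp add: c distrib_right sum.distrib if_distrib[of "\<lambda>t. t * _"] cong: if_cong)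
  then show ?case by (intro exI[of _ "\<lambda>j. (if j = i then a else 0) + c j"]) blast
qed

lemma span_functionals_vanish:
  assumes "\<phi> \<in> functionals.span F" and "\<forall>L\<in>F. L x = (0::'a::field)"
  shows "\<phi> x = 0"
  using assms(1) by (induction rule: functionals.span_induct_alt) (use assms(2) in auto)

lemma (in vector_space) functional_module_homI:
  assumes "\<And>x y. L (x + y) = L x + L y" and "\<And>a x. L (scale a x) = a * L x"
  shows "module_hom scale (*) L"
  by unfold_locales (auto simp: assms algebra_simps)

text \<open>By induction on \<open>F\<close>: if \<open>M\<close> does not vanish on the common kernel of \<open>F\<close>, say at \<open>v\<close>,
then subtracting the multiple of \<open>M\<close> that agrees with \<open>\<phi>\<close> at \<open>v\<close> leaves a functional that
vanishes on the common kernel of \<open>F\<close>.\<close>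

lemma (in vector_space) in_span_functionals:
  assumes "finite F" and "\<forall>L\<in>F. module_hom scale (*) L" and "module_hom scale (*) \<phi>"
    and "\<And>x. \<forall>L\<in>F. L x = 0 \<Longrightarrow> \<phi> x = 0"
  shows "\<phi> \<in> functionals.span F"
  using assms
proof (induction F arbitrary: \<phi> rule: finite_induct)
  case empty
  then have "\<phi> = 0" by (auto simp: fun_eq_iff)
  then show ?case by (simp only: functionals.span_zero)
next
  case (insert M F)
  have M: "module_hom scale (*) M" using insert.prems by simp
  note \<phi> = \<open>module_hom scale (*) \<phi>\<close>
  note hom = module_hom.add module_hom.scale module_hom.diff
  show ?case
  proof (cases "\<exists>v. (\<forall>L\<in>F. L v = 0) \<and> M v \<noteq> 0")
    case False
    then have "\<phi> \<in> functionals.span F"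
      using insert.prems by (intro insert.IH) auto
    then show ?thesis by (rule subsetD[OF functionals.span_mono[OF subset_insertI]])
  next
    case True
    then obtain v where v: "\<forall>L\<in>F. L v = 0" "M v \<noteq> 0" by blast
    define a where "a = \<phi> v / M v"
    define \<psi> where "\<psi> = (\<lambda>x. \<phi> x - a * M x)"
    have "\<psi> \<in> functionals.span F"
    proof (rule insert.IH)
      show "\<forall>L\<in>F. module_hom scale (*) L" using insert.prems by simp
      show "module_hom scale (*) \<psi>"
        by (rule functional_module_homI)
           (simp_all add: \<psi>_def hom[OF \<phi>] hom[OF M] algebra_simps)
      fix x assume x: "\<forall>L\<in>F. L x = 0"
      \<comment> \<open>the projection of \<open>x\<close> along \<open>v\<close> to the common kernel of \<open>insert M F\<close>\<close>
      define y where "y = x - scale (M x / M v) v"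
      have "\<forall>L\<in>insert M F. L y = 0"
      proof
        fix L assume "L \<in> insert M F"
        then have "module_hom scale (*) L" using insert.prems by blast
        then show "L y = 0"
          using \<open>L \<in> insert M F\<close> v x by (auto simp: y_def hom)
      qed
      then have "\<phi> y = 0" using insert.prems by blast
      then show "\<psi> x = 0"
        using v by (simp add: y_def \<psi>_def a_def hom[OF \<phi>])
    qed
    then have "\<psi> \<in> functionals.span (insert M F)"
      by (rule subsetD[OF functionals.span_mono[OF subset_insertI]])
    moreover have "scale_fun a M \<in> functionals.span (insert M F)"
      by (intro functionals.span_scale functionals.span_base) simp
    ultimately have "\<psi> + scale_fun a M \<in> functionals.span (insert M F)"
      by (rule functionals.span_add)
    also have "\<psi> + scale_fun a M = \<phi>" by (rule ext) (simp add: \<psi>_def)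
    finally show ?thesis .
  qed
qed

section \<open>Subspaces of finite codimension\<close>

interpretation polys: vector_space "smult :: 'a::field \<Rightarrow> _"
  by unfold_locales (auto simp: smult_add_right smult_add_left)

abbreviation linear_functional :: "('a::field poly \<Rightarrow> 'a) \<Rightarrow> bool" where
  "linear_functional \<equiv> module_hom smult (*)"

lemmas linear_functionalI = polys.functional_module_homI

text \<open>The coordinates of \<open>p\<close> modulo \<open>A\<close> with respect to the basis \<open>b\<close> of the quotient: a family
that is dual to \<open>b\<close> and has \<open>A\<close> as its common kernel.\<close>

lemma coordinate_functionals:
  fixes A :: "'a::field poly set"
  assumes A: "module.subspace smult A" and "has_codim A n"
  shows "\<exists>\<phi> b. (\<forall>k<n. linear_functional (\<phi> k)) \<and>
    (\<forall>i<n. \<forall>k<n. \<phi> k (b i) = (if i = k then 1 else 0)) \<and>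
    (\<forall>p. p \<in> A \<longleftrightarrow> (\<forall>k<n. \<phi> k p = 0))"
proof -
  from assms obtain b where ind: "\<And>c i. (\<Sum>i<n. smult (c i) (b i)) \<in> A \<Longrightarrow> i < n \<Longrightarrow> c i = 0"
    and gen: "\<And>p. \<exists>c. p - (\<Sum>i<n. smult (c i) (b i)) \<in> A"
    unfolding has_codim_def by blast
  define \<phi> where "\<phi> k p = (SOME c. p - (\<Sum>i<n. smult (c i) (b i)) \<in> A) k" for k p
  have \<phi>: "p - (\<Sum>i<n. smult (\<phi> i p) (b i)) \<in> A" for p
    using someI_ex[OF gen[of p]] by (simp add: \<phi>_def)
  have eq: "\<phi> k p = c k" if "p - (\<Sum>i<n. smult (c i) (b i)) \<in> A" "k < n" for k p c
  proof -
    have "(p - (\<Sum>i<n. smult (c i) (b i))) - (p - (\<Sum>i<n. smult (\<phi> i p) (b i))) \<in> A"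
      using polys.subspace_diff[OF A that(1) \<phi>] .
    then have "(\<Sum>i<n. smult (\<phi> i p - c i) (b i)) \<in> A"
      by (simp add: smult_diff_left sum_subtractf algebra_simps)
    from ind[OF this that(2)] show ?thesis by simp
  qed
  show ?thesis
  proof (intro exI[of _ \<phi>] exI[of _ b] conjI allI impI)
    fix k assume k: "k < n"
    show "linear_functional (\<phi> k)"
    proof (rule linear_functionalI)
      fix p q a
      have "(p - (\<Sum>i<n. smult (\<phi> i p) (b i))) + (q - (\<Sum>i<n. smult (\<phi> i q) (b i))) \<in> A"
        using polys.subspace_add[OF A \<phi> \<phi>] .
      then show "\<phi> k (p + q) = \<phi> k p + \<phi> k q"
        by (intro eq[where c = "\<lambda>k. \<phi> k p + \<phi> k q"] k)
           (simp add: smult_add_left sum.distrib algebra_simps)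
      have "smult a (p - (\<Sum>i<n. smult (\<phi> i p) (b i))) \<in> A"
        using polys.subspace_scale[OF A \<phi>] .
      then show "\<phi> k (smult a p) = a * \<phi> k p"
        by (intro eq[where c = "\<lambda>k. a * \<phi> k p"] k)
           (simp add: smult_diff_right polys.scale_sum_right)
    qed
  next
    fix i k assume "i < n" "k < n"
    then show "\<phi> k (b i) = (if i = k then 1 else 0)"
      using polys.subspace_0[OF A]
      by (intro eq[where c = "\<lambda>k. if i = k then 1 else 0"])
         (simp_all add: if_distrib[of "\<lambda>t. smult t _"] cong: if_cong)
  next
    fix p
    show "p \<in> A \<longleftrightarrow> (\<forall>k<n. \<phi> k p = 0)"
      using eq[of p "\<lambda>_. 0"] \<phi>[of p] by auto
  qed
qed

text \<open>Independent families of functionals that cut out the same subspace have the same span, hence the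
same size; the coordinate functionals are one such family, with \<open>n\<close> elements.\<close>

lemma card_independent_functionals:
  fixes A :: "'a::field poly set"
  assumes A: "module.subspace smult A" "has_codim A n"
    and B: "finite B" "\<forall>L\<in>B. linear_functional L" "functionals.independent B"
    and A_eq: "\<And>p. p \<in> A \<longleftrightarrow> (\<forall>L\<in>B. L p = 0)"
  shows "card B = n"
proof -
  obtain \<phi> b where \<phi>: "\<forall>k<n. linear_functional (\<phi> k)"
    and dual: "\<forall>i<n. \<forall>k<n. \<phi> k (b i) = (if i = k then 1 else 0)"
    and A_\<phi>: "\<forall>p. p \<in> A \<longleftrightarrow> (\<forall>k<n. \<phi> k p = 0)"
    using coordinate_functionals[OF A] by (elim exE conjE)
  let ?\<Phi> = "\<phi> ` {..<n}"
  have inj: "inj_on \<phi> {..<n}"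
  proof (rule inj_onI)
    fix i k assume "i \<in> {..<n}" "k \<in> {..<n}" "\<phi> i = \<phi> k"
    then show "i = k" using dual[rule_format, of i i] dual[rule_format, of i k] by (simp split: if_splits)
  qed
  have "functionals.independent ?\<Phi>"
  proof (rule functionals.independent_if_scalars_zero)
    fix f x assume sum: "(\<Sum>L\<in>?\<Phi>. scale_fun (f L) L) = 0" and "x \<in> ?\<Phi>"
    then obtain k where k: "k < n" "x = \<phi> k" by blast
    have "(\<Sum>i<n. f (\<phi> i) * \<phi> i (b k)) = 0"
      using fun_cong[OF sum, of "b k"] by (simp add: sum_fun_apply sum.reindex[OF inj])
    also have "(\<Sum>i<n. f (\<phi> i) * \<phi> i (b k)) = (\<Sum>i<n. if i = k then f (\<phi> i) else 0)"
      by (rule sum.cong) (auto simp: dual k)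
    finally show "f x = 0" using k by simp
  qed simp
  moreover have "?\<Phi> \<subseteq> functionals.span B"
  proof
    fix L assume "L \<in> ?\<Phi>"
    then show "L \<in> functionals.span B"
      using \<phi> A_eq A_\<phi> by (intro polys.in_span_functionals B) auto
  qed
  moreover have "B \<subseteq> functionals.span ?\<Phi>"
  proof
    fix L assume L: "L \<in> B"
    show "L \<in> functionals.span ?\<Phi>"
    proof (rule polys.in_span_functionals)
      show "L p = 0" if "\<forall>M\<in>?\<Phi>. M p = 0" for p
        using that L A_eq[of p] A_\<phi>[rule_format, of p] by blast
    qed (use B(2) L \<phi> in auto)
  qed
  ultimately have "card B = card ?\<Phi>"
    using functionals.independent_span_bound[of B ?\<Phi>]
      functionals.independent_span_bound[of ?\<Phi> B] B by auto
  then show ?thesis using card_image[OF inj] by simp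
qed

text \<open>If the common kernel were zero, \<open>F\<close> would span every functional, but the infinitely many
functionals taking a coefficient are independent.\<close>

lemma finite_functionals_common_zero:
  fixes F :: "('a::field poly \<Rightarrow> 'a) set"
  assumes "finite F" and "\<forall>L\<in>F. linear_functional L"
  shows "\<exists>q. q \<noteq> 0 \<and> (\<forall>L\<in>F. L q = 0)"
proof (rule ccontr)
  assume no: "\<not> ?thesis"
  let ?C = "\<lambda>k (p::'a poly). coeff p k"
  have "range ?C \<subseteq> functionals.span F"
  proof (clarify, rule polys.in_span_functionals[OF assms])
    show "linear_functional (?C k)" for k by (rule linear_functionalI) simp_all
    show "?C k x = 0" if "\<forall>L\<in>F. L x = 0" for k x using no that by (cases "x = 0") auto
  qed
  moreover have "functionals.independent (range ?C)"
    unfolding functionals.independent_explicit_finite_subsets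
  proof (intro allI impI ballI)
    fix S u v
    assume S: "S \<subseteq> range ?C" "finite S" "(\<Sum>L\<in>S. scale_fun (u L) L) = 0" and v: "v \<in> S"
    then obtain k where k: "v = ?C k" by blast
    have "0 = (\<Sum>L\<in>S. u L * L (monom 1 k))"
      using fun_cong[OF S(3), of "monom 1 k"] by (simp add: sum_fun_apply)
    also have "\<dots> = (\<Sum>L\<in>S. if L = v then u v else 0)"
    proof (rule sum.cong)
      fix L assume "L \<in> S"
      then obtain j where "L = ?C j" using S(1) by blast
      moreover from this have "L = v" if "j = k" using that k by blast
      moreover have "L \<noteq> v" if "j \<noteq> k"
        using that \<open>L = ?C j\<close> by (auto simp: k fun_eq_iff intro!: exI[of _ "monom 1 k"])
      ultimately show "u L * L (monom 1 k) = (if L = v then u v else 0)"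
        by (cases "j = k") auto
    qed simp
    finally show "u v = 0" using S v by simp
  qed
  ultimately have "finite (range ?C)"
    using functionals.independent_span_bound assms by blast
  moreover have "inj ?C"
    by (rule injI) (metis coeff_monom one_neq_zero)
  ultimately show False by (simp add: finite_image_iff)
qed

text \<open>Membership of \<open>T q\<close> in \<open>A\<close> amounts to finitely many linear conditions on \<open>q\<close>. This replaces all
dimension counts in the construction of the conductor.\<close>

lemma finite_codim_meets_range:
  fixes A :: "'a::field poly set"
  assumes "module.subspace smult A" "has_codim A n"
    and T: "module_hom smult smult T"
  shows "\<exists>q. q \<noteq> 0 \<and> T q \<in> A"
proof -
  interpret T: module_hom smult smult T by fact
  obtain \<phi> where \<phi>: "\<forall>k<n. linear_functional (\<phi> k)"
    and A_\<phi>: "\<forall>p. p \<in> A \<longleftrightarrow> (\<forall>k<n. \<phi> k p = 0)"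
    using coordinate_functionals[OF assms(1,2)] by (elim exE conjE)
  have "\<exists>q. q \<noteq> 0 \<and> (\<forall>L \<in> (\<lambda>k p. \<phi> k (T p)) ` {..<n}. L q = 0)"
  proof (rule finite_functionals_common_zero)
    show "\<forall>L \<in> (\<lambda>k p. \<phi> k (T p)) ` {..<n}. linear_functional L"
      using \<phi> by (auto intro!: linear_functionalI simp: T.add T.scale module_hom_iff)
  qed simp
  then show ?thesis by (auto simp: A_\<phi>)
qed

section \<open>The conductor of a subalgebra\<close>

context
  fixes A :: "'a::field poly set"
  assumes A: "is_subalgebra A"
begin

lemma subalgebra_add: "p \<in> A \<Longrightarrow> q \<in> A \<Longrightarrow> p + q \<in> A"
  using A polys.subspace_add unfolding is_subalgebra_def by blast

lemma subalgebra_smult: "p \<in> A \<Longrightarrow> smult a p \<in> A"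
  using A polys.subspace_scale unfolding is_subalgebra_def by blast

lemma subalgebra_mult: "p \<in> A \<Longrightarrow> q \<in> A \<Longrightarrow> p * q \<in> A"
  using A unfolding is_subalgebra_def by blast

lemma subalgebra_const: "[:a:] \<in> A"
proof -
  have "1 \<in> A" using A unfolding is_subalgebra_def by blast
  from subalgebra_smult[OF this, of a] show ?thesis by simp
qed

lemma subalgebra_diff_const: "p \<in> A \<Longrightarrow> p - [:a:] \<in> A"
  using subalgebra_add[of p "[:- a:]"] subalgebra_const[of "- a"]
  by (simp only: diff_conv_add_uminus minus_pCons minus_zero)

lemma subalgebra_sum: "(\<And>i. i \<in> I \<Longrightarrow> p i \<in> A) \<Longrightarrow> sum p I \<in> A"
  using subalgebra_const[of 0] by (induction I rule: infinite_finite_induct) (auto intro: subalgebra_add)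

lemma subalgebra_prod: "(\<And>i. i \<in> I \<Longrightarrow> p i \<in> A) \<Longrightarrow> prod p I \<in> A"
  using subalgebra_const[of 1]
  by (induction I rule: infinite_finite_induct) (auto intro: subalgebra_mult simp: one_pCons)

lemma subalgebra_power: "p \<in> A \<Longrightarrow> p ^ k \<in> A"
  using subalgebra_prod[of "{..<k}" "\<lambda>_. p"] by simp

lemma subalgebra_pcompose: "f \<in> A \<Longrightarrow> pcompose c f \<in> A"
  using subalgebra_const[of 0]
  by (induction c) (auto simp: pcompose_pCons intro!: subalgebra_add subalgebra_mult subalgebra_const)

text \<open>Let \<open>f \<in> A\<close> be nonconstant, of degree \<open>d\<close>. For each monomial \<open>x\<^sup>i\<close> with \<open>i < d\<close> there is a nonzero
\<open>h\<close> in \<open>K[f]\<close> with \<open>x\<^sup>i h \<in> A\<close>. The product \<open>g\<close> of these multiplies all polynomials of degree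
below \<open>d\<close> into \<open>A\<close>, and then, by repeated division by \<open>f\<close>, all polynomials.\<close>

lemma conductor_nonzero:
  assumes codim: "has_codim A n"
  shows "\<exists>g. g \<noteq> 0 \<and> (\<forall>p. g * p \<in> A)"
proof -
  have sub: "module.subspace smult A" using A unfolding is_subalgebra_def by blast
  have "\<exists>q. q \<noteq> 0 \<and> pCons 0 q \<in> A"
    by (rule finite_codim_meets_range[OF sub codim])
       (use polys.module_axioms in \<open>simp add: module_hom_iff\<close>)
  then obtain f where f: "f \<in> A" "degree f > 0"
    by (metis degree_pCons_eq zero_less_Suc)
  have "\<exists>c. c \<noteq> 0 \<and> monom 1 i * pcompose c f \<in> A" for i
    by (rule finite_codim_meets_range[OF sub codim])
       (use polys.module_axioms in \<open>simp add: module_hom_iff pcompose_add pcompose_smult algebra_simps\<close>)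
  then obtain c where c: "\<And>i. c i \<noteq> 0" "\<And>i. monom 1 i * pcompose (c i) f \<in> A" by metis
  define g where "g = (\<Prod>i<degree f. pcompose (c i) f)"
  have "g \<noteq> 0"
    using c(1) f(2) by (auto simp: g_def pcompose_eq_0_iff)
  have monom: "g * monom 1 i \<in> A" if "i < degree f" for i
  proof -
    have "g * monom 1 i = (monom 1 i * pcompose (c i) f) * (\<Prod>i\<in>{..<degree f} - {i}. pcompose (c i) f)"
      unfolding g_def using that by (subst prod.remove[of _ i]) (auto simp: mult_ac)
    then show ?thesis
      by (simp only:) (intro subalgebra_mult[OF c(2)] subalgebra_prod subalgebra_pcompose f(1))
  qed
  have low: "g * r \<in> A" if "degree r < degree f" for r
  proof -
    have "r = (\<Sum>i<degree f. smult (coeff r i) (monom 1 i))"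
      using poly_as_sum_of_monoms'[of r "degree f - 1"] that
      by (simp add: smult_monom lessThan_Suc_atMost[symmetric])
    then have "g * r = (\<Sum>i<degree f. smult (coeff r i) (g * monom 1 i))"
      by (metis (no_types, lifting) mult_smult_right sum.cong sum_distrib_left)
    then show ?thesis using monom by (auto intro!: subalgebra_sum subalgebra_smult)
  qed
  have "g * p \<in> A" for p
  proof (induction "degree p" arbitrary: p rule: less_induct)
    case less
    show ?case
    proof (cases "degree p < degree f")
      case False
      have "g * (p div f) \<in> A"
        using False f(2) by (intro less degree_div_less) auto
      moreover have "g * (p mod f) \<in> A"
        using f(2) degree_mod_less[of f p] by (intro low) (cases "f = 0"; cases "p mod f = 0"; auto)
      moreover have "g * p = f * (g * (p div f)) + g * (p mod f)"
        by (metis (no_types, lifting) distrib_left mult.left_commute mult_div_mod_eq)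
      ultimately show ?thesis
        using f(1) by (auto intro: subalgebra_add subalgebra_mult)
    qed (rule low)
  qed
  with \<open>g \<noteq> 0\<close> show ?thesis by blast
qed

end

section \<open>Roots of the conductor\<close>

text \<open>For each root \<open>\<beta>\<close> of \<open>h\<close> take an element of \<open>A\<close> that vanishes at \<open>\<beta>\<close> but not at \<open>\<alpha>\<close>, and
multiply these, with multiplicities.\<close>

lemma multiple_avoiding_point:
  fixes A :: "'a::alg_closed_field poly set"
  assumes A: "is_subalgebra A"
    and sep: "\<And>\<beta>. \<beta> \<noteq> \<alpha> \<Longrightarrow> \<exists>f\<in>A. poly f \<alpha> \<noteq> poly f \<beta>"
    and "poly h \<alpha> \<noteq> 0"
  shows "\<exists>e\<in>A. h dvd e \<and> poly e \<alpha> \<noteq> 0"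
  using \<open>poly h \<alpha> \<noteq> 0\<close>
proof (induction "degree h" arbitrary: h)
  case 0
  then have "is_unit h" by (metis is_unit_iff_degree poly_0)
  then show ?case using subalgebra_const[OF A, of 1] by (intro bexI[of _ "[:1:]"]) auto
next
  case (Suc d)
  then obtain \<beta> where "poly h \<beta> = 0"
    using alg_closed_imp_poly_has_root[of h] by auto
  then obtain k where h: "h = [:-\<beta>, 1:] * k" by (auto simp: poly_eq_0_iff_dvd)
  have "\<beta> \<noteq> \<alpha>" "poly k \<alpha> \<noteq> 0" "k \<noteq> 0"
    using Suc.prems \<open>poly h \<beta> = 0\<close> by (auto simp: h)
  then have "d = degree k" using Suc.hyps(2) by (simp add: h degree_mult_eq del: mult_pCons_left)
  then obtain e where e: "e \<in> A" "k dvd e" "poly e \<alpha> \<noteq> 0"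
    using Suc.hyps(1) \<open>poly k \<alpha> \<noteq> 0\<close> by blast
  obtain f where f: "f \<in> A" "poly f \<alpha> \<noteq> poly f \<beta>" using sep[OF \<open>\<beta> \<noteq> \<alpha>\<close>] by blast
  let ?f = "f - [:poly f \<beta>:]"
  have "[:-\<beta>, 1:] dvd ?f" by (simp add: poly_eq_0_iff_dvd[symmetric])
  then have "h dvd ?f * e" unfolding h using e(2) by (rule mult_dvd_mono)
  moreover have "?f * e \<in> A"
    using subalgebra_mult[OF A] subalgebra_diff_const[OF A] e f by blast
  ultimately show ?case using e f by (intro bexI[of _ "?f * e"]) auto
qed

text \<open>Suppose that \<open>\<alpha>\<close> is not in the spectrum, and let \<open>q\<close> be \<open>g\<close> without one factor
\<open>x - \<alpha>\<close>. Then \<open>A\<close> contains a multiple \<open>q w\<close> of \<open>q\<close> with \<open>w(\<alpha>) \<noteq> 0\<close>. Any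
\<open>p\<close> differs from a constant multiple of \<open>w\<close> by a polynomial that vanishes at \<open>\<alpha>\<close>, and \<open>q\<close> times
the latter is a multiple of \<open>g\<close>. So \<open>q p \<in> A\<close> for all \<open>p\<close>, against the minimality of \<open>g\<close>.\<close>

lemma conductor_root_in_spectrum:
  fixes A :: "'a::{alg_closed_field,field_char_0} poly set"
  assumes A: "is_subalgebra A"
    and g: "g \<noteq> 0" "\<And>p. g * p \<in> A"
    and minimal: "\<And>q. q \<noteq> 0 \<Longrightarrow> (\<And>p. q * p \<in> A) \<Longrightarrow> degree g \<le> degree q"
    and root: "poly g \<alpha> = 0"
  shows "\<alpha> \<in> spectrum A"
proof (rule ccontr)
  assume "\<alpha> \<notin> spectrum A"
  then obtain f where f: "f \<in> A" "poly (pderiv f) \<alpha> \<noteq> 0"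
    and sep: "\<And>\<beta>. \<beta> \<noteq> \<alpha> \<Longrightarrow> \<exists>f\<in>A. poly f \<alpha> \<noteq> poly f \<beta>"
    unfolding spectrum_def by blast
  let ?X = "[:-\<alpha>, 1:]"
  obtain u where u: "f - [:poly f \<alpha>:] = ?X * u"
    using poly_eq_0_iff_dvd[of "f - [:poly f \<alpha>:]" \<alpha>] by auto
  have "poly (pderiv (f - [:poly f \<alpha>:])) \<alpha> = poly u \<alpha>"
    unfolding u by (subst pderiv_mult) (simp add: pderiv_pCons)
  then have "poly u \<alpha> \<noteq> 0" using f by (simp add: pderiv_diff pderiv_pCons)
  obtain h where h: "g = ?X ^ order \<alpha> g * h" "\<not> ?X dvd h"
    using order_decomp[OF g(1)] by blast
  have "poly h \<alpha> \<noteq> 0" using h(2) by (simp add: poly_eq_0_iff_dvd)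
  then obtain e where e: "e \<in> A" "h dvd e" "poly e \<alpha> \<noteq> 0"
    using multiple_avoiding_point[OF A sep] by blast
  then obtain v where v: "e = h * v" by blast
  obtain m where m: "order \<alpha> g = Suc m"
    using root g(1) order_root not0_implies_Suc by blast
  define q where "q = ?X ^ m * h"
  have g_q: "g = ?X * q" using h(1) by (simp only: q_def m power_Suc mult.assoc)
  \<comment> \<open>\<open>e\<close> supplies the factor \<open>h\<close>, the powers of \<open>f - f(\<alpha>)\<close> supply those of \<open>x - \<alpha>\<close>\<close>
  have w: "q * (u ^ m * v) \<in> A"
  proof -
    have "e * (f - [:poly f \<alpha>:]) ^ m \<in> A"
      using A e f by (intro subalgebra_mult subalgebra_power subalgebra_diff_const)
    also have "e * (f - [:poly f \<alpha>:]) ^ m = q * (u ^ m * v)"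
      by (simp only: u v q_def power_mult_distrib mult_ac)
    finally show ?thesis .
  qed
  have "q * p \<in> A" for p
  proof -
    let ?a = "poly p \<alpha> / poly (u ^ m * v) \<alpha>"
    have "poly (u ^ m * v) \<alpha> \<noteq> 0"
      using e(3) \<open>poly u \<alpha> \<noteq> 0\<close> by (simp add: v poly_power)
    then have "poly (p - smult ?a (u ^ m * v)) \<alpha> = 0" by simp
    then obtain r where r: "p - smult ?a (u ^ m * v) = ?X * r"
      unfolding poly_eq_0_iff_dvd by (elim dvdE)
    have "q * p = smult ?a (q * (u ^ m * v)) + q * (p - smult ?a (u ^ m * v))"
      by (simp add: algebra_simps)
    also have "q * (p - smult ?a (u ^ m * v)) = g * r"
      unfolding r g_q by (simp only: mult_ac)
    finally show ?thesis
      using subalgebra_add[OF A subalgebra_smult[OF A w] g(2)] by simp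
  qed
  moreover have "q \<noteq> 0" using g(1) g_q by auto
  ultimately have "degree g \<le> degree q" using minimal by blast
  moreover have "degree g = Suc (degree q)"
    unfolding g_q using \<open>q \<noteq> 0\<close> by (subst degree_mult_eq) auto
  ultimately show False by simp
qed

lemma dvd_if_order_le:
  fixes g p :: "'a::alg_closed_field poly"
  assumes "g \<noteq> 0" "p \<noteq> 0" and "\<And>a. poly g a = 0 \<Longrightarrow> order a g \<le> order a p"
  shows "g dvd p"
  using assms
proof (induction "degree g" arbitrary: g p)
  case 0
  then show ?case by (metis is_unit_iff_degree unit_imp_dvd)
next
  case (Suc d)
  then obtain a where a: "poly g a = 0"
    using alg_closed_imp_poly_has_root[of g] by auto
  then obtain h where h: "g = [:-a, 1:] * h" by (auto simp: poly_eq_0_iff_dvd)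
  have "order a g \<noteq> 0" using a Suc.prems(1) order_root by blast
  then have "poly p a = 0" using Suc.prems(3)[OF a] order_0I[of p a] by auto
  then obtain r where r: "p = [:-a, 1:] * r" by (auto simp: poly_eq_0_iff_dvd)
  have nz: "h \<noteq> 0" "r \<noteq> 0" using Suc.prems h r by auto
  then have "d = degree h" using Suc.hyps(2) by (simp add: h degree_mult_eq del: mult_pCons_left)
  moreover have "order b h \<le> order b r" if "poly h b = 0" for b
  proof -
    have "order b g \<le> order b p" using that by (intro Suc.prems) (simp add: h)
    then show ?thesis
      using Suc.prems(1,2) unfolding h r by (simp add: order_mult del: mult_pCons_left)
  qed
  ultimately have "h dvd r" using nz Suc.hyps(1) by blast
  then show ?case unfolding h r by (rule mult_dvd_mono[OF dvd_refl])
qed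

lemma order_ge_if_higher_pderiv_zero:
  fixes p :: "'a::field_char_0 poly"
  assumes "p \<noteq> 0" and "\<And>i. i < N \<Longrightarrow> poly ((pderiv ^^ i) p) a = 0"
  shows "N \<le> order a p"
  using assms
proof (induction N arbitrary: p)
  case (Suc N)
  have root: "poly p a = 0" using Suc.prems(2)[of 0] by simp
  have "pderiv p \<noteq> 0"
  proof
    assume "pderiv p = 0"
    then obtain b where "p = [:b:]" by (metis degree_eq_zeroE pderiv_eq_0_iff)
    then show False using root Suc.prems(1) by simp
  qed
  moreover have "poly ((pderiv ^^ i) (pderiv p)) a = 0" if "i < N" for i
    using Suc.prems(2)[of "Suc i"] that by (simp add: funpow_swap1)
  ultimately have "N \<le> order a (pderiv p)" by (rule Suc.IH)
  then show ?case using order_pderiv[OF Suc.prems(1) root] by simp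
qed simp

text \<open>The order of vanishing that suffices is the degree of a polynomial \<open>g\<close> of least degree in the
conductor: such a \<open>g\<close> divides \<open>p\<close>, since its roots lie in the spectrum.\<close>

lemma mem_if_derivatives_vanish_on_spectrum:
  fixes A :: "'a::{alg_closed_field,field_char_0} poly set"
  assumes A: "is_subalgebra A" and "has_codim A n"
  shows "\<exists>N>1. \<forall>p. (\<forall>i<N. \<forall>a\<in>spectrum A. poly ((pderiv ^^ i) p) a = 0) \<longrightarrow> p \<in> A"
proof -
  obtain g where g: "g \<noteq> 0" "\<And>p. g * p \<in> A"
    and minimal: "\<And>q. q \<noteq> 0 \<Longrightarrow> (\<And>p. q * p \<in> A) \<Longrightarrow> degree g \<le> degree q"
    using conductor_nonzero[OF assms]
      ex_has_least_nat[of "\<lambda>g. g \<noteq> 0 \<and> (\<forall>p. g * p \<in> A)" _ degree] by metis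
  \<comment> \<open>\<open>degree g\<close> bounds the order of every root of \<open>g\<close>; the summand ensures \<open>N > 1\<close>\<close>
  define N where "N = degree g + 2"
  have "p \<in> A" if p: "\<forall>i<N. \<forall>a\<in>spectrum A. poly ((pderiv ^^ i) p) a = 0" for p
  proof (cases "p = 0")
    case True
    then show ?thesis using subalgebra_const[OF A, of 0] by simp
  next
    case False
    have "g dvd p"
    proof (rule dvd_if_order_le[OF g(1) False])
      fix a assume "poly g a = 0"
      with conductor_root_in_spectrum[OF A g minimal] have "a \<in> spectrum A" by blast
      then have "N \<le> order a p"
        using p by (intro order_ge_if_higher_pderiv_zero False) blast
      then show "order a g \<le> order a p"
        using order_degree[OF g(1), of a] by (simp add: N_def)
    qed
    then show ?thesis using g(2) by auto
  qed
  then show ?thesis by (intro exI[of _ N]) (auto simp: N_def)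
qed



section \<open>The annihilator of a subspace\<close>

definition annihilator :: "'a::field poly set \<Rightarrow> ('a poly \<Rightarrow> 'a) set" where
  "annihilator A = {L. linear_functional L \<and> (\<forall>p\<in>A. L p = 0)}"

text \<open>With \<open>E\<close> empty this yields defining conditions for \<open>A\<close>, exactly \<open>n\<close> of them, chosen from any set
that spans the annihilator; in general the conditions in \<open>E\<close> can be prescribed.\<close>

lemma annihilator_basis:
  fixes A :: "'a::field poly set"
  assumes A: "module.subspace smult A" "has_codim A n"
    and E: "functionals.independent E" "E \<subseteq> V"
    and V: "V \<subseteq> annihilator A" "annihilator A \<subseteq> functionals.span V"
  shows "\<exists>B. E \<subseteq> B \<and> B \<subseteq> V \<and> finite B \<and> card B = n \<and> (\<forall>p. p \<in> A \<longleftrightarrow> (\<forall>L\<in>B. L p = 0))"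
proof -
  obtain \<phi> where \<phi>: "\<forall>k<n. linear_functional (\<phi> k)"
    and A_\<phi>: "\<forall>p. p \<in> A \<longleftrightarrow> (\<forall>k<n. \<phi> k p = 0)"
    using coordinate_functionals[OF A] by (elim exE conjE)
  obtain B where B: "E \<subseteq> B" "B \<subseteq> V" "functionals.independent B" "V \<subseteq> functionals.span B"
    using functionals.maximal_independent_subset_extend[OF E(2,1)] .
  have "B \<subseteq> functionals.span (\<phi> ` {..<n})"
  proof
    fix L assume "L \<in> B"
    then have L: "linear_functional L" "\<forall>p\<in>A. L p = 0"
      using B(2) V(1) by (auto simp: annihilator_def)
    show "L \<in> functionals.span (\<phi> ` {..<n})"
    proof (rule polys.in_span_functionals)
      show "L p = 0" if "\<forall>M\<in>\<phi> ` {..<n}. M p = 0" for p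
        using that L(2) A_\<phi>[rule_format, of p] by blast
    qed (use \<phi> L in auto)
  qed
  then have fin: "finite B"
    using functionals.independent_span_bound[OF _ B(3)] by blast
  have mem: "p \<in> A \<longleftrightarrow> (\<forall>L\<in>B. L p = 0)" for p
  proof
    assume "p \<in> A"
    then show "\<forall>L\<in>B. L p = 0" using B(2) V(1) by (auto simp: annihilator_def)
  next
    assume p: "\<forall>L\<in>B. L p = 0"
    have "\<phi> k p = 0" if "k < n" for k
    proof -
      have "\<phi> k \<in> annihilator A" using \<phi> A_\<phi> that by (simp add: annihilator_def)
      moreover have "functionals.span V \<subseteq> functionals.span B"
        using B(4) by (intro functionals.span_minimal functionals.subspace_span)
      ultimately have "\<phi> k \<in> functionals.span B" using V(2) by blast
      then show ?thesis using p by (rule span_functionals_vanish)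
    qed
    then show "p \<in> A" using A_\<phi> by blast
  qed
  have "\<forall>L\<in>B. linear_functional L"
    using B(2) V(1) by (auto simp: annihilator_def)
  then have "card B = n"
    using card_independent_functionals[OF A fin _ B(3) mem] by blast
  then show ?thesis using B fin mem by (intro exI[of _ B]) blast
qed

lemma linear_functional_higher_pderiv: "linear_functional (\<lambda>p. poly ((pderiv ^^ i) p) a)"
  by (rule linear_functionalI) (simp_all add: higher_pderiv_add higher_pderiv_smult)

lemma linear_functional_derivative_combination:
  "linear_functional (\<lambda>p. \<Sum>i\<in>I. \<Sum>j\<in>J. c i j * poly ((pderiv ^^ i) p) (\<alpha> j))"
  by (rule linear_functionalI)
     (simp_all add: higher_pderiv_add higher_pderiv_smult sum.distrib sum_distrib_left algebra_simps)

lemma annihilator_derivative_form: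
  fixes \<alpha> :: "nat \<Rightarrow> 'a::field"
  assumes mem: "\<And>p. \<forall>i<N. \<forall>a\<in>\<alpha> ` {1..s}. poly ((pderiv ^^ i) p) a = 0 \<Longrightarrow> p \<in> A"
    and L: "L \<in> annihilator A"
  shows "\<exists>c. \<forall>p. L p = (\<Sum>i<N. \<Sum>j=1..s. c i j * poly ((pderiv ^^ i) p) (\<alpha> j))"
proof -
  let ?D = "\<lambda>(i, j) p. poly ((pderiv ^^ i) p) (\<alpha> j)"
  let ?I = "{..<N} \<times> {1..s}"
  have "L \<in> functionals.span (?D ` ?I)"
  proof (rule polys.in_span_functionals)
    show "L p = 0" if "\<forall>M\<in>?D ` ?I. M p = 0" for p
    proof -
      have "p \<in> A" using that by (intro mem) auto
      then show ?thesis using L by (simp add: annihilator_def)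
    qed
  qed (use L in \<open>auto simp: annihilator_def linear_functional_higher_pderiv\<close>)
  then obtain c where "\<And>p. L p = (\<Sum>x\<in>?I. c x * ?D x p)"
    using span_image_functionals[of ?I L ?D] by auto
  then show ?thesis
    by (intro exI[of _ "\<lambda>i j. c (i, j)"]) (simp add: sum.cartesian_product case_prod_unfold)
qed

section \<open>Subalgebras with a single cluster\<close>

lemma single_cluster_imp_equal_values:
  assumes "card (clusters A) = 1"
  shows "spectrum A \<noteq> {}"
    and "f \<in> A \<Longrightarrow> \<beta> \<in> spectrum A \<Longrightarrow> \<gamma> \<in> spectrum A \<Longrightarrow> poly f \<beta> = poly f \<gamma>"
proof -
  obtain X where X: "clusters A = {X}" using assms by (metis card_1_singletonE)
  then show "spectrum A \<noteq> {}" by (auto simp: clusters_def)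
  assume f: "f \<in> A" and "\<beta> \<in> spectrum A" "\<gamma> \<in> spectrum A"
  then have "cluster_rel A `` {\<beta>} = X" "cluster_rel A `` {\<gamma>} = X"
    using X quotientI[of _ "spectrum A" "cluster_rel A"] unfolding clusters_def by blast+
  then have "(\<beta>, \<gamma>) \<in> cluster_rel A"
    using equiv_cluster_rel \<open>\<gamma> \<in> spectrum A\<close> by (metis eq_equiv_class)
  then show "poly f \<beta> = poly f \<gamma>" using f by (simp add: cluster_rel_def)
qed

text \<open>The polynomials vanishing at all but one of the points form a family dual to the differences, up
to nonzero factors.\<close>

lemma independent_value_differences:
  fixes \<alpha> :: "nat \<Rightarrow> 'a::field"
  assumes inj: "inj_on \<alpha> {1..s}"
  defines "E \<equiv> \<lambda>j p. poly p (\<alpha> 1) - poly p (\<alpha> j)"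
  shows "inj_on E {2..s}" and "functionals.independent (E ` {2..s})"
proof -
  define P where "P j = (\<Prod>i\<in>{1..s} - {j}. [:- \<alpha> i, 1:])" for j
  have P: "poly (P j) (\<alpha> i) = 0 \<longleftrightarrow> i \<noteq> j" if "i \<in> {1..s}" "j \<in> {1..s}" for i j
  proof -
    have "poly (P j) (\<alpha> i) = 0 \<longleftrightarrow> (\<exists>k\<in>{1..s} - {j}. \<alpha> i = \<alpha> k)"
      by (simp add: P_def poly_prod)
    also have "\<dots> \<longleftrightarrow> (\<exists>k\<in>{1..s} - {j}. i = k)"
      using inj_on_eq_iff[OF inj that(1)] by (intro bex_cong) auto
    finally show ?thesis using that by blast
  qed
  have EP: "E i (P j) = 0 \<longleftrightarrow> i \<noteq> j" if "i \<in> {2..s}" "j \<in> {2..s}" for i j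
    using that P[of 1 j] P[of i j] by (auto simp: E_def)
  show inj_E: "inj_on E {2..s}"
    by (rule inj_onI) (metis EP)
  show "functionals.independent (E ` {2..s})"
  proof (rule functionals.independent_if_scalars_zero)
    fix f x assume sum: "(\<Sum>L\<in>E ` {2..s}. scale_fun (f L) L) = 0" and "x \<in> E ` {2..s}"
    then obtain j where j: "j \<in> {2..s}" "x = E j" by blast
    have "0 = (\<Sum>i=2..s. f (E i) * E i (P j))"
      using fun_cong[OF sum, of "P j"] by (simp add: sum_fun_apply sum.reindex[OF inj_E])
    also have "\<dots> = (\<Sum>i=2..s. if i = j then f (E j) * E j (P j) else 0)"
      using EP j(1) by (intro sum.cong) auto
    also have "\<dots> = f (E j) * E j (P j)" using j(1) by simp
    finally show "f x = 0" using EP[OF j(1) j(1)] j(2) by simp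
  qed simp
qed

text \<open>Evaluating a functional from the annihilator at the constant \<open>1\<close> shows that the coefficients
\<open>c 0 j\<close> of its order-zero terms add up to \<open>0\<close>. Therefore these terms equal a combination of the
differences \<open>E j\<close>, which is itself in the annihilator; the remaining part lies in \<open>\<Psi>\<close>.\<close>

lemma single_cluster_annihilator_span:
  fixes \<alpha> :: "nat \<Rightarrow> 'a::field" and A :: "'a poly set"
  assumes "1 \<in> A" and "s \<ge> 1"
    and mem: "\<And>p. \<forall>i<Suc N. \<forall>a\<in>\<alpha> ` {1..s}. poly ((pderiv ^^ i) p) a = 0 \<Longrightarrow> p \<in> A"
  defines "E \<equiv> \<lambda>j p. poly p (\<alpha> 1) - poly p (\<alpha> j)"
    and "\<Psi> \<equiv> {L. \<exists>c. L = (\<lambda>p. \<Sum>i=1..N. \<Sum>j=1..s. c i j * poly ((pderiv ^^ i) p) (\<alpha> j))}"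
  assumes E: "E ` {2..s} \<subseteq> annihilator A"
  shows "annihilator A \<subseteq> functionals.span (E ` {2..s} \<union> (\<Psi> \<inter> annihilator A))"
proof
  fix L assume L: "L \<in> annihilator A"
  let ?S = "functionals.span (E ` {2..s} \<union> (\<Psi> \<inter> annihilator A))"
  obtain c where c: "\<And>p. L p = (\<Sum>i<Suc N. \<Sum>j=1..s. c i j * poly ((pderiv ^^ i) p) (\<alpha> j))"
    using annihilator_derivative_form[OF mem L] by blast
  define \<psi> where "\<psi> = (\<lambda>p. \<Sum>i=1..N. \<Sum>j=1..s. c i j * poly ((pderiv ^^ i) p) (\<alpha> j))"
  have split: "L p = (\<Sum>j=1..s. c 0 j * poly p (\<alpha> j)) + \<psi> p" for p
    unfolding c \<psi>_def lessThan_Suc_atMost atMost_atLeast0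
    by (simp add: sum.atLeast_Suc_atMost)
  have "\<psi> 1 = 0"
    unfolding \<psi>_def
  proof (intro sum.neutral ballI)
    fix i j assume "i \<in> {1..N}"
    then obtain k where "i = Suc k" by (cases i) auto
    then show "c i j * poly ((pderiv ^^ i) 1) (\<alpha> j) = 0"
      by (simp add: funpow_Suc_right del: funpow.simps)
  qed
  then have c0: "(\<Sum>j=1..s. c 0 j) = 0"
    using split[of 1] L \<open>1 \<in> A\<close> by (simp add: annihilator_def)
  have eq: "L p = \<psi> p - (\<Sum>j=2..s. c 0 j * E j p)" for p
  proof -
    have "(\<Sum>j=1..s. c 0 j * poly p (\<alpha> j)) = - (\<Sum>j=1..s. c 0 j * E j p)"
    proof -
      have "(\<Sum>j=1..s. c 0 j * E j p) =
          (\<Sum>j=1..s. c 0 j) * poly p (\<alpha> 1) - (\<Sum>j=1..s. c 0 j * poly p (\<alpha> j))"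
        unfolding E_def sum_distrib_right by (simp add: right_diff_distrib sum_subtractf)
      then show ?thesis using c0 by simp
    qed
    \<comment> \<open>\<open>E 1\<close> is zero\<close>
    also have "(\<Sum>j=1..s. c 0 j * E j p) = (\<Sum>j=2..s. c 0 j * E j p)"
      using \<open>s \<ge> 1\<close> by (simp add: sum.atLeast_Suc_atMost E_def numeral_2_eq_2)
    finally show ?thesis by (simp add: split)
  qed
  have "\<psi> \<in> \<Psi>" unfolding \<Psi>_def \<psi>_def by blast
  moreover have "\<psi> \<in> annihilator A"
    unfolding annihilator_def
  proof (intro CollectI conjI ballI)
    show "linear_functional \<psi>"
      unfolding \<psi>_def by (rule linear_functional_derivative_combination)
    fix p assume "p \<in> A"
    then have "(\<Sum>j=2..s. c 0 j * E j p) = 0"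
      using E by (intro sum.neutral) (auto simp: annihilator_def)
    then show "\<psi> p = 0"
      using eq[of p] L \<open>p \<in> A\<close> by (simp add: annihilator_def)
  qed
  ultimately have "\<psi> \<in> ?S" by (intro functionals.span_base) blast
  moreover have "(\<Sum>j=2..s. scale_fun (c 0 j) (E j)) \<in> ?S"
    by (intro functionals.span_sum functionals.span_scale functionals.span_base) blast
  ultimately have "\<psi> - (\<Sum>j=2..s. scale_fun (c 0 j) (E j)) \<in> ?S"
    by (rule functionals.span_diff)
  also have "\<psi> - (\<Sum>j=2..s. scale_fun (c 0 j) (E j)) = L"
    by (rule ext) (simp add: eq sum_fun_apply)
  finally show "L \<in> ?S" .
qed

theorem theorem14:
  fixes A :: "'a::{alg_closed_field, field_char_0} poly set"
    and n s :: nat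
    and \<alpha> :: "nat \<Rightarrow> 'a"
  assumes "is_subalgebra A"
    and "has_codim A n"
    and "n > 1"
    and "bij_betw \<alpha> {1..s} (spectrum A)"
  shows "\<exists>N>1.
     (\<exists>c :: nat \<Rightarrow> nat \<Rightarrow> nat \<Rightarrow> 'a. \<forall>p.
        p \<in> A \<longleftrightarrow>
        (\<forall>k\<in>{1..n}.
           (\<Sum>i=0..N-1. \<Sum>j=1..s. c k i j * poly ((pderiv ^^ i) p) (\<alpha> j)) = 0)) \<and>
     (card (clusters A) = 1 \<longrightarrow>
       (\<exists>m. (s - 1) + m = n \<and>
         (\<exists>c :: nat \<Rightarrow> nat \<Rightarrow> nat \<Rightarrow> 'a. \<forall>p.
            p \<in> A \<longleftrightarrow>
            (\<forall>j\<in>{2..s}. poly p (\<alpha> 1) = poly p (\<alpha> j)) \<and>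
            (\<forall>k\<in>{1..m}.
               (\<Sum>i=1..N-1. \<Sum>j=1..s. c k i j * poly ((pderiv ^^ i) p) (\<alpha> j)) = 0))))"
proof -
  have sub: "module.subspace smult A" and "1 \<in> A"
    using assms(1) unfolding is_subalgebra_def by blast+
  have spec: "spectrum A = \<alpha> ` {1..s}" and inj: "inj_on \<alpha> {1..s}"
    using assms(4) by (auto simp: bij_betw_def)
  obtain N where "N > 1"
    and mem: "\<And>p. \<forall>i<N. \<forall>a\<in>\<alpha> ` {1..s}. poly ((pderiv ^^ i) p) a = 0 \<Longrightarrow> p \<in> A"
    using mem_if_derivatives_vanish_on_spectrum[OF assms(1,2)] unfolding spec by blast
  have Suc_N: "Suc (N - 1) = N" using \<open>N > 1\<close> by simp
  have part1: "\<exists>c :: nat \<Rightarrow> nat \<Rightarrow> nat \<Rightarrow> 'a. \<forall>p. p \<in> A \<longleftrightarrow>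
    (\<forall>k\<in>{1..n}. (\<Sum>i=0..N-1. \<Sum>j=1..s. c k i j * poly ((pderiv ^^ i) p) (\<alpha> j)) = 0)"
  proof -
    obtain B where B: "B \<subseteq> annihilator A" "finite B" "card B = n"
      and A_B: "\<And>p. p \<in> A \<longleftrightarrow> (\<forall>L\<in>B. L p = 0)"
      using annihilator_basis[OF sub assms(2) functionals.independent_empty empty_subsetI
          subset_refl functionals.span_superset] by blast
    obtain h where h: "h ` {1..n} = B"
      using ex_bij_betw_nat_finite_1[OF B(2)] B(3) by (auto simp: bij_betw_def)
    have "\<exists>c. \<forall>p. h k p = (\<Sum>i=0..N-1. \<Sum>j=1..s. c i j * poly ((pderiv ^^ i) p) (\<alpha> j))"
      if "k \<in> {1..n}" for k
    proof -
      have "h k \<in> annihilator A" using that h B(1) by blast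
      moreover have "{0..N-1} = {..<N}" using \<open>N > 1\<close> by auto
      ultimately show ?thesis
        using annihilator_derivative_form[where N = N and \<alpha> = \<alpha> and s = s and L = "h k", OF mem]
        by (simp only:)
    qed
    then have "\<forall>k\<in>{1..n}. \<exists>c. \<forall>p. h k p =
        (\<Sum>i=0..N-1. \<Sum>j=1..s. c i j * poly ((pderiv ^^ i) p) (\<alpha> j))"
      by (rule ballI)
    from bchoice[OF this] obtain c where c: "\<forall>k\<in>{1..n}. \<forall>p.
        h k p = (\<Sum>i=0..N-1. \<Sum>j=1..s. c k i j * poly ((pderiv ^^ i) p) (\<alpha> j))"
      by (elim exE)
    have "p \<in> A \<longleftrightarrow> (\<forall>k\<in>{1..n}. h k p = 0)" for p
      unfolding A_B h[symmetric] by blast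
    then show ?thesis
      using c by (intro exI[of _ c]) simp
  qed
  have part2: "\<exists>m. (s - 1) + m = n \<and> (\<exists>c :: nat \<Rightarrow> nat \<Rightarrow> nat \<Rightarrow> 'a. \<forall>p. p \<in> A \<longleftrightarrow>
      (\<forall>j\<in>{2..s}. poly p (\<alpha> 1) = poly p (\<alpha> j)) \<and>
      (\<forall>k\<in>{1..m}. (\<Sum>i=1..N-1. \<Sum>j=1..s. c k i j * poly ((pderiv ^^ i) p) (\<alpha> j)) = 0))"
    if "card (clusters A) = 1"
  proof -
    define E where "E = (\<lambda>j p. poly p (\<alpha> 1) - poly p (\<alpha> j))"
    define \<Psi> where "\<Psi> = {L. \<exists>c. L =
      (\<lambda>p. \<Sum>i=1..N-1. \<Sum>j=1..s. c i j * poly ((pderiv ^^ i) p) (\<alpha> j))}"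
    note equal = single_cluster_imp_equal_values[OF that, unfolded spec]
    have "s \<ge> 1" using equal(1) by (cases s) auto
    have E_ann: "E ` {2..s} \<subseteq> annihilator A"
    proof clarify
      fix j assume "j \<in> {2..s}"
      then show "E j \<in> annihilator A"
        using equal(2)[of _ "\<alpha> 1" "\<alpha> j"]
        by (auto simp: annihilator_def E_def algebra_simps intro!: linear_functionalI)
    qed
    have span: "annihilator A \<subseteq> functionals.span (E ` {2..s} \<union> (\<Psi> \<inter> annihilator A))"
      unfolding E_def \<Psi>_def
    proof (rule single_cluster_annihilator_span[OF \<open>1 \<in> A\<close> \<open>s \<ge> 1\<close>])
      fix p assume "\<forall>i<Suc (N - 1). \<forall>a\<in>\<alpha> ` {1..s}. poly ((pderiv ^^ i) p) a = 0"
      then show "p \<in> A" unfolding Suc_N by (rule mem)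
    qed (use E_ann in \<open>simp only: E_def\<close>)
    have indep: "inj_on E {2..s}" "functionals.independent (E ` {2..s})"
      unfolding E_def using independent_value_differences[OF inj] by blast+
    have "E ` {2..s} \<union> (\<Psi> \<inter> annihilator A) \<subseteq> annihilator A"
      using E_ann by blast
    then obtain B where B: "E ` {2..s} \<subseteq> B" "B \<subseteq> E ` {2..s} \<union> (\<Psi> \<inter> annihilator A)"
        "finite B" "card B = n"
      and A_B: "\<And>p. p \<in> A \<longleftrightarrow> (\<forall>L\<in>B. L p = 0)"
      using annihilator_basis[OF sub assms(2) indep(2) Un_upper1 _ span] by blast
    define m where "m = card (B - E ` {2..s})"
    have "card (E ` {2..s}) = s - 1" using card_image[OF indep(1)] by simp
    then have m: "(s - 1) + m = n"
      using card_Diff_subset[OF _ B(1)] card_mono[OF B(3,1)] B(4) by (simp add: m_def)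
    obtain h where h: "h ` {1..m} = B - E ` {2..s}"
      using ex_bij_betw_nat_finite_1[of "B - E ` {2..s}"] B(3) by (auto simp: bij_betw_def m_def)
    have "\<forall>k\<in>{1..m}. \<exists>c. h k =
        (\<lambda>p. \<Sum>i=1..N-1. \<Sum>j=1..s. c i j * poly ((pderiv ^^ i) p) (\<alpha> j))"
    proof
      fix k assume "k \<in> {1..m}"
      then have "h k \<in> \<Psi>" using h B(2) by blast
      then show "\<exists>c. h k = (\<lambda>p. \<Sum>i=1..N-1. \<Sum>j=1..s. c i j * poly ((pderiv ^^ i) p) (\<alpha> j))"
        unfolding \<Psi>_def by (rule CollectD)
    qed
    from bchoice[OF this] obtain c where c: "\<forall>k\<in>{1..m}. h k =
        (\<lambda>p. \<Sum>i=1..N-1. \<Sum>j=1..s. c k i j * poly ((pderiv ^^ i) p) (\<alpha> j))"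
      by (elim exE)
    have "p \<in> A \<longleftrightarrow> (\<forall>j\<in>{2..s}. poly p (\<alpha> 1) = poly p (\<alpha> j)) \<and>
      (\<forall>k\<in>{1..m}. (\<Sum>i=1..N-1. \<Sum>j=1..s. c k i j * poly ((pderiv ^^ i) p) (\<alpha> j)) = 0)" for p
    proof -
      have "B = E ` {2..s} \<union> h ` {1..m}" using h B(1) by blast
      then have "p \<in> A \<longleftrightarrow> (\<forall>j\<in>{2..s}. E j p = 0) \<and> (\<forall>k\<in>{1..m}. h k p = 0)"
        unfolding A_B by blast
      then show ?thesis by (simp add: E_def c)
    qed
    then show ?thesis using m by blast
  qed
  show ?thesis
    using \<open>N > 1\<close> part1 part2 by blast
qed

end
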